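(* Let $T$ be an uncertainty polynomial functor, $D$ a Lindenbaum $T$-deduction system, $\Delta S\in\mathsf{Ing}\,T$ and $x\in X_{\Delta S}$. For $\varphi::S$ put $\mu_x(|\varphi|_S)=\sup\{q\in[0,1]:\mathsf P_{\ge q}\varphi\in x\}$. Then $\mu_x$ is a well-defined (depending only on $|\varphi|_S$) finitely additive probability measure on $(X_S,\Sigma_S)$.
   Context: Uncertainty spaces. An uncertainty space is $(X,\Sigma)$ with $\Sigma$ an algebra of subsets of $X$ (nonempty, closed under finite unions and complements $U^c=X\setminus U$). A (finitely additive) probability measure is $\mu:\Sigma\to[0,1]$ with $\mu(\emptyset)=0$, $\mu(X)=1$, $\mu(U\cup V)=\mu(U)+\mu(V)$ for disjoint $U,V$. An upper probability measure is $g(U)=\sup_{\mu\in\mathcal P}\mu(U)$ for a nonempty set $\mathcal P$ of probability measures. A plausibility measure is $\gamma:\Sigma\to[0,1]$ with $\gamma(\emptyset)=0$, $\gamma(X)=1$, $\gamma(U_1\cap\dots\cap U_n)\le\sum_{\emptyset\ne I\subseteq J_n}(-1)^{|I|+1}\gamma(\bigcup_{i\in I}U_i)$ ($n\ge1$, $J_n=\{1,\dots,n\}$). A possibility measure is $\pi:\Sigma\to[0,1]$ with $\pi(\emptyset)=0$, $\pi(X)=1$, $\pi(U\cup V)=\max\{\pi(U),\pi(V)\}$. $\Delta^*X,\Delta X,\Delta_{Pl}X,\Delta_{Ps}X$ are the sets of these four kinds of measures, with algebras generated by $\beta^{p,q}(U)=\{g:g(U)\ge p,1-g(U^c)\ge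 q\}$, $\beta^p_{pr}(U)=\{\mu:\mu(U)\ge p\}$, $\beta^{p,q}_{Pl}(U)$, $\beta^{p,q}_{Ps}(U)$ (defined like $\beta^{p,q}$). Products, coproducts and constant functors (with space $(M,\Sigma_M)$) as usual. Uncertainty polynomial functors: smallest class of endofunctors containing $Id$ and constants, closed under pointwise $\times$, $+$ and composition with $\Delta^*,\Delta,\Delta_{Pl},\Delta_{Ps}$. Language. $\mathsf{Ing}\,T$: $\mathsf{Ing}\,Id=\{Id\}$, $\mathsf{Ing}\,M=\{M,Id\}$, $\mathsf{Ing}(T_1\times T_2)=\{T_1\times T_2\}\cup\mathsf{Ing}\,T_1\cup\mathsf{Ing}\,T_2$, same for $+$, $\mathsf{Ing}\,US=\{US\}\cup\mathsf{Ing}\,S$ for $U\in\{\Delta^*,\Delta,\Delta_{Pl},\Delta_{Ps}\}$. Formulas of sort $S$ ($\mathsf{Form}_S$): $\bot_S$; $\varphi\to\psi$; $A:M$ for $A\in\Sigma_M$ or $A=\{m\}$; $[\mathsf{pr}_j]\varphi:S_1\times S_2$ ($\varphi:S_j$); $[\mathsf{in}_j]\varphi:S_1+S_2$ ($\varphi:S_j$); $[\mathsf{next}]\varphi:Id$ ($\varphi:T$); for $\varphi::S$ (all constant subformulas in $\Sigma_M$) and $p,q\in[0,1]$: $[(p,q)]\varphi:\Delta^*S$, $\mathsf P_{\ge p}\varphi:\Delta S$, $[(p,q)]_{Pl}\varphi:\Delta_{Pl}S$, $[(p,q)]_{Ps}\varphi:\Delta_{Ps}S$. Non-probabilistic labels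 $\kappa\in\{\mathsf{pr}_j,\mathsf{in}_j,\mathsf{next}\}$. Abbreviations: $\neg,\vee,\wedge,\leftrightarrow,\top_S$; $\mathsf U_{\ge p}=[(p,0)]$, $\mathsf L_{\ge p}=[(0,p)]$, $\mathsf U_{\le p}\varphi=[(0,1-p)]\neg\varphi$, $\mathsf U_{<p}=\neg\mathsf U_{\ge p}$; $\mathsf P_{<p}\varphi=\neg\mathsf P_{\ge p}\varphi$, $\mathsf P_{\le p}\varphi=\mathsf P_{\ge1-p}\neg\varphi$; $\mathsf{Pl}_{\ge p}=[(p,0)]_{Pl}$, $\mathsf{Bel}_{\ge p}=[(0,p)]_{Pl}$, $\mathsf{Pl}_{\le p}\varphi=[(0,1-p)]_{Pl}\neg\varphi$, $\mathsf{Bel}_{\le p}\varphi=[(1-p,0)]_{Pl}\neg\varphi$, $\mathsf{Pl}_{<p}=\neg\mathsf{Pl}_{\ge p}$, $\mathsf{Bel}_{<p}=\neg\mathsf{Bel}_{\ge p}$; $\mathsf{Ps},\mathsf N$ analogously with $[(\cdot,\cdot)]_{Ps}$. $\mathsf{Pl}_{[i]p}$ is $\mathsf{Pl}_{\le p}$ for odd $i$, $\mathsf{Pl}_{\ge p}$ for even $i$; $\psi_I=\bigvee_{i\in I}\varphi_i$. Axioms $Ax_S$ ($\varphi,\psi::S'$ in measure cases): Boolean tautologies; $\{c\}\to A$ ($c\in A$), $\{c\}\to\neg A$ ($c\notin A$); $\neg[\kappa]\varphi\to[\kappa]\neg\varphi$; $\neg[\mathsf{pr}_j]\bot$; $\neg[\mathsf{in}_1]\bot_{S_1}\leftrightarrow[\mathsf{in}_2]\bot_{S_2}$;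 $\neg[\mathsf{next}]\bot_T$. $\Delta^*S'$: $\mathsf U_{\le p}\varphi\to\mathsf U_{<q}\varphi$ ($p<q$); $\mathsf U_{<p}\varphi\to\mathsf U_{\le p}\varphi$; $\mathsf L_{\ge1}(\varphi\to\psi)\to(\mathsf U_{\ge p}\varphi\to\mathsf U_{\ge p}\psi)$; $[(p,q)]\varphi\leftrightarrow(\mathsf U_{\ge p}\varphi\wedge\mathsf L_{\ge q}\varphi)$. $\Delta S'$: $\mathsf P_{\le p}\varphi\to\mathsf P_{<q}\varphi$ ($p<q$); $\mathsf P_{<p}\varphi\to\mathsf P_{\le p}\varphi$; $\mathsf P_{\ge1}(\varphi\to\psi)\to(\mathsf P_{\ge p}\varphi\to\mathsf P_{\ge p}\psi)$. $\Delta_{Pl}S'$: $\mathsf{Pl}_{\le p}\varphi\to\mathsf{Pl}_{<q}\varphi$ ($p<q$); $\mathsf{Pl}_{<p}\varphi\to\mathsf{Pl}_{\le p}\varphi$; $\mathsf{Pl}_{\le p}\varphi\to\mathsf{Bel}_{\le p}\varphi$; $\mathsf{Bel}_{\ge1}(\varphi\to\psi)\to(\mathsf{Pl}_{\ge p}\varphi\to\mathsf{Pl}_{\ge p}\psi)$; $[(p,q)]_{Pl}\varphi\leftrightarrow(\mathsf{Pl}_{\ge p}\varphi\wedge\mathsf{Bel}_{\ge q}\varphi)$; for $\varphi_1,\dots,\varphi_n::S'$, $p_I\in[0,1]$ ($\emptyset\ne I\subseteq J_n$), $q=\sum_I(-1)^{|I|+1}p_I$: if $q\ge0$, $p=\min(q,1)$: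 $(\bigwedge_I\mathsf{Pl}_{[|I|]p_I}\psi_I)\to\mathsf{Pl}_{\le p}(\bigwedge_i\varphi_i)$; if $q<0$: $\neg\bigwedge_I\mathsf{Pl}_{[|I|]p_I}\psi_I$. $\Delta_{Ps}S'$: $\mathsf{Ps}_{\le p}\varphi\to\mathsf{Ps}_{<q}\varphi$ ($p<q$); $\mathsf{Ps}_{<p}\varphi\to\mathsf{Ps}_{\le p}\varphi$; $\mathsf{Ps}_{\le0}\bot_{S'}$; $\mathsf{Ps}_{\le p}\varphi\to\mathsf N_{\le p}\varphi$; $(\mathsf{Ps}_{\le p}\varphi\wedge\mathsf{Ps}_{\le q}\psi)\to\mathsf{Ps}_{\le\max(p,q)}(\varphi\vee\psi)$; $\mathsf N_{\ge1}(\varphi\to\psi)\to(\mathsf{Ps}_{\ge p}\varphi\to\mathsf{Ps}_{\ge p}\psi)$; $[(p,q)]_{Ps}\varphi\leftrightarrow(\mathsf{Ps}_{\ge p}\varphi\wedge\mathsf N_{\ge q}\varphi)$. A $T$-deduction system is a family $\vdash_S\subseteq\mathcal P(\mathsf{Form}_S)\times\mathsf{Form}_S$ ($\vdash_S\varphi$ means $\emptyset\vdash_S\varphi$) satisfying: Assumption ($\varphi\in\Gamma\cup Ax_S\Rightarrow\Gamma\vdash_S\varphi$); Modus ponens $\{\varphi,\varphi\to\psi\}\vdash_S\psi$; Cut (if $\Gamma\vdash_S\psi$ for all $\psi\in\Lambda$ and $\Lambda\vdash_S\varphi$ then $\Gamma\vdash_S\varphi$); Deduction; Constant ($\{\neg\{c\}:c\in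 M\}\vdash_M\bot_M$); Definite box ($\Gamma\vdash_{S'}\psi\Rightarrow[\kappa]\Gamma\vdash_S[\kappa]\psi$); Necessitation (for $\varphi::S$, $\vdash_S\varphi$ implies $\vdash_{\Delta^*S}\mathsf L_{\ge1}\varphi$, $\vdash_{\Delta S}\mathsf P_{\ge1}\varphi$, $\vdash_{\Delta_{Pl}S}\mathsf{Bel}_{\ge1}\varphi$, $\vdash_{\Delta_{Ps}S}\mathsf N_{\ge1}\varphi$ when these sorts are ingredients); Archimedean ($\{\mathsf O_{\ge q}\psi:q<p\}\vdash\mathsf O_{\ge p}\psi$ for $\mathsf O\in\{\mathsf U,\mathsf L,\mathsf P,\mathsf{Pl},\mathsf{Bel},\mathsf{Ps},\mathsf N\}$); Cover rules for $\mathsf O\in\{\mathsf U,\mathsf P\}$ at sorts $\Delta^*S$, resp. $\Delta S$, with $\varphi,\varphi_i::S$, $k\ge0$: (C1) if $n\ge1$, $\vdash_S\varphi\to\bigvee_{I\subseteq J_m,|I|=n+k}\bigwedge_{i\in I}\varphi_i$, $\vdash_S\bigvee_{I\subseteq J_m,|I|=k}\bigwedge_{i\in I}\varphi_i$, $p_i\in[0,1]$, $p=\max(0,\min(1,(\sum p_i-k)/n))$, then $\vdash(\bigwedge_i\mathsf O_{\le p_i}\varphi_i)\to\mathsf O_{\le p}\varphi$; (C2) if $\vdash_S\bigvee_{I\subseteq J_m,|I|=k}\bigwedge_{i\in I}\varphi_i$ and $\sum p_i<k$, then $\vdash\neg\bigwedge_i\mathsf O_{\le p_i}\varphi_i$.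 $\Gamma$ is $\vdash_S$-consistent if $\Gamma\not\vdash_S\bot_S$; $\vdash_S$-maximal if consistent and negation complete ($\varphi\in\Gamma$ iff $\neg\varphi\notin\Gamma$). $D$ is Lindenbaum if every consistent set extends to a maximal one. $X_S$ = set of $\vdash_S$-maximal sets, $|\varphi|_S=\{y\in X_S:\varphi\in y\}$, $\Sigma_S=\{|\varphi|_S:\varphi::S\}$. *)

theory Defs
  imports "HOL-Analysis.Sigma_Algebra"
begin

section \<open>Uncertainty spaces and finitely additive probability measures\<close>

text \<open>An uncertainty space is a pair with \<^term>\<open>algebra X \<Sigma>\<close> (the library's locale of
  algebras of sets). Measures are total functions of which only the values on \<open>\<Sigma>\<close> matter.\<close>

definition fin_add_prob :: "'x set \<Rightarrow> 'x set set \<Rightarrow> ('x set \<Rightarrow> real) \<Rightarrow> bool" where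
  "fin_add_prob X \<Sigma> \<mu> \<longleftrightarrow>
     algebra X \<Sigma> \<and>
     (\<forall>U\<in>\<Sigma>. 0 \<le> \<mu> U \<and> \<mu> U \<le> 1) \<and>
     \<mu> {} = 0 \<and> \<mu> X = 1 \<and>
     (\<forall>U\<in>\<Sigma>. \<forall>V\<in>\<Sigma>. U \<inter> V = {} \<longrightarrow> \<mu> (U \<union> V) = \<mu> U + \<mu> V)"


section \<open>Uncertainty polynomial functors\<close>

text \<open>Functors are represented by the expressions that build them, since ingredients and sorts
  are defined by recursion on these expressions. All constant spaces live on subsets of one
  ambient type \<^typ>\<open>'m\<close>; the arguments of \<open>ConstF\<close> are the carrier and its algebra.
  \<open>UpF\<close>, \<open>PrF\<close>, \<open>PlF\<close>, \<open>PsF\<close> stand for composition with $\Delta^*$, $\Delta$,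
  $\Delta_{Pl}$, $\Delta_{Ps}$.\<close>

datatype 'm ufun =
    IdF
  | ConstF "'m set" "'m set set"
  | ProdF "'m ufun" "'m ufun"
  | SumF "'m ufun" "'m ufun"
  | UpF "'m ufun"
  | PrF "'m ufun"
  | PlF "'m ufun"
  | PsF "'m ufun"

inductive uncertainty_functor :: "'m ufun \<Rightarrow> bool" where
  "uncertainty_functor IdF"
| "algebra M \<Sigma> \<Longrightarrow> uncertainty_functor (ConstF M \<Sigma>)"
| "uncertainty_functor S1 \<Longrightarrow> uncertainty_functor S2 \<Longrightarrow> uncertainty_functor (ProdF S1 S2)"
| "uncertainty_functor S1 \<Longrightarrow> uncertainty_functor S2 \<Longrightarrow> uncertainty_functor (SumF S1 S2)"
| "uncertainty_functor S \<Longrightarrow> uncertainty_functor (UpF S)"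
| "uncertainty_functor S \<Longrightarrow> uncertainty_functor (PrF S)"
| "uncertainty_functor S \<Longrightarrow> uncertainty_functor (PlF S)"
| "uncertainty_functor S \<Longrightarrow> uncertainty_functor (PsF S)"

primrec Ing :: "'m ufun \<Rightarrow> 'm ufun set" where
  "Ing IdF = {IdF}"
| "Ing (ConstF M \<Sigma>) = {ConstF M \<Sigma>, IdF}"
| "Ing (ProdF S1 S2) = {ProdF S1 S2} \<union> Ing S1 \<union> Ing S2"
| "Ing (SumF S1 S2) = {SumF S1 S2} \<union> Ing S1 \<union> Ing S2"
| "Ing (UpF S) = {UpF S} \<union> Ing S"
| "Ing (PrF S) = {PrF S} \<union> Ing S"
| "Ing (PlF S) = {PlF S} \<union> Ing S"
| "Ing (PsF S) = {PsF S} \<union> Ing S"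


section \<open>Formulas\<close>

datatype label = Pr1 | Pr2 | In1 | In2 | Next

text \<open>\<open>BoxU p q \<phi>\<close>, \<open>BoxP p \<phi>\<close>, \<open>BoxPl p q \<phi>\<close>, \<open>BoxPs p q \<phi>\<close> are $[(p,q)]\varphi$,
  $\mathsf{P}_{\ge p}\varphi$, $[(p,q)]_{Pl}\varphi$, $[(p,q)]_{Ps}\varphi$. The constant formula
  $A$ of sort $M$ carries its space, \<open>Cst M \<Sigma> A\<close>, just as falsum carries its sort.\<close>

datatype 'm form =
    Bot "'m ufun"
  | Imp "'m form" "'m form"
  | Cst "'m set" "'m set set" "'m set"
  | Box label "'m form"
  | BoxU real real "'m form"
  | BoxP real "'m form"
  | BoxPl real real "'m form"
  | BoxPs real real "'m form"

text \<open>All constant subformulas are measurable; this is what distinguishes $\varphi :: S$ from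
  $\varphi : S$.\<close>

primrec const_measurable :: "'m form \<Rightarrow> bool" where
  "const_measurable (Bot S) = True"
| "const_measurable (Imp \<phi> \<psi>) = (const_measurable \<phi> \<and> const_measurable \<psi>)"
| "const_measurable (Cst M \<Sigma> A) = (A \<in> \<Sigma>)"
| "const_measurable (Box \<kappa> \<phi>) = const_measurable \<phi>"
| "const_measurable (BoxU p q \<phi>) = const_measurable \<phi>"
| "const_measurable (BoxP p \<phi>) = const_measurable \<phi>"
| "const_measurable (BoxPl p q \<phi>) = const_measurable \<phi>"
| "const_measurable (BoxPs p q \<phi>) = const_measurable \<phi>"

text \<open>\<open>label_sort T \<kappa> S' S\<close>: the modality $[\kappa]$ sends formulas of sort \<open>S'\<close> to formulas of
  sort \<open>S\<close>.\<close>

inductive label_sort :: "'m ufun \<Rightarrow> label \<Rightarrow> 'm ufun \<Rightarrow> 'm ufun \<Rightarrow> bool" for T where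
  "ProdF S1 S2 \<in> Ing T \<Longrightarrow> label_sort T Pr1 S1 (ProdF S1 S2)"
| "ProdF S1 S2 \<in> Ing T \<Longrightarrow> label_sort T Pr2 S2 (ProdF S1 S2)"
| "SumF S1 S2 \<in> Ing T \<Longrightarrow> label_sort T In1 S1 (SumF S1 S2)"
| "SumF S1 S2 \<in> Ing T \<Longrightarrow> label_sort T In2 S2 (SumF S1 S2)"
| "label_sort T Next T IdF"

inductive has_sort :: "'m ufun \<Rightarrow> 'm form \<Rightarrow> 'm ufun \<Rightarrow> bool" for T where
  Bot: "S \<in> Ing T \<Longrightarrow> has_sort T (Bot S) S"
| Imp: "has_sort T \<phi> S \<Longrightarrow> has_sort T \<psi> S \<Longrightarrow> has_sort T (Imp \<phi> \<psi>) S"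
| Cst: "ConstF M \<Sigma> \<in> Ing T \<Longrightarrow> A \<in> \<Sigma> \<or> (\<exists>m\<in>M. A = {m}) \<Longrightarrow>
        has_sort T (Cst M \<Sigma> A) (ConstF M \<Sigma>)"
| Box: "label_sort T \<kappa> S' S \<Longrightarrow> has_sort T \<phi> S' \<Longrightarrow> has_sort T (Box \<kappa> \<phi>) S"
| BoxU: "UpF S \<in> Ing T \<Longrightarrow> has_sort T \<phi> S \<Longrightarrow> const_measurable \<phi> \<Longrightarrow>
        p \<in> {0..1} \<Longrightarrow> q \<in> {0..1} \<Longrightarrow> has_sort T (BoxU p q \<phi>) (UpF S)"
| BoxP: "PrF S \<in> Ing T \<Longrightarrow> has_sort T \<phi> S \<Longrightarrow> const_measurable \<phi> \<Longrightarrow>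
        p \<in> {0..1} \<Longrightarrow> has_sort T (BoxP p \<phi>) (PrF S)"
| BoxPl: "PlF S \<in> Ing T \<Longrightarrow> has_sort T \<phi> S \<Longrightarrow> const_measurable \<phi> \<Longrightarrow>
        p \<in> {0..1} \<Longrightarrow> q \<in> {0..1} \<Longrightarrow> has_sort T (BoxPl p q \<phi>) (PlF S)"
| BoxPs: "PsF S \<in> Ing T \<Longrightarrow> has_sort T \<phi> S \<Longrightarrow> const_measurable \<phi> \<Longrightarrow>
        p \<in> {0..1} \<Longrightarrow> q \<in> {0..1} \<Longrightarrow> has_sort T (BoxPs p q \<phi>) (PsF S)"

definition Form :: "'m ufun \<Rightarrow> 'm ufun \<Rightarrow> 'm form set" where
  "Form T S = {\<phi>. has_sort T \<phi> S}"

definition MForm :: "'m ufun \<Rightarrow> 'm ufun \<Rightarrow> 'm form set" where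
  "MForm T S = {\<phi>. has_sort T \<phi> S \<and> const_measurable \<phi>}"


subsection \<open>Abbreviations of the language\<close>

text \<open>Negation is implication of the falsum of the same sort, so the Boolean connectives take the
  sort as first argument.\<close>

definition Neg :: "'m ufun \<Rightarrow> 'm form \<Rightarrow> 'm form" where
  "Neg S \<phi> = Imp \<phi> (Bot S)"

definition Top :: "'m ufun \<Rightarrow> 'm form" where
  "Top S = Neg S (Bot S)"

definition Or :: "'m ufun \<Rightarrow> 'm form \<Rightarrow> 'm form \<Rightarrow> 'm form" where
  "Or S \<phi> \<psi> = Imp (Neg S \<phi>) \<psi>"

definition And :: "'m ufun \<Rightarrow> 'm form \<Rightarrow> 'm form \<Rightarrow> 'm form" where
  "And S \<phi> \<psi> = Neg S (Imp \<phi> (Neg S \<psi>))"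

definition Iff :: "'m ufun \<Rightarrow> 'm form \<Rightarrow> 'm form \<Rightarrow> 'm form" where
  "Iff S \<phi> \<psi> = And S (Imp \<phi> \<psi>) (Imp \<psi> \<phi>)"

text \<open>Finite conjunctions and disjunctions over an index set are formed along an arbitrary fixed
  enumeration without repetitions; the empty ones are verum and falsum.\<close>

definition enum_of :: "'i set \<Rightarrow> 'i list" where
  "enum_of A = (SOME xs. set xs = A \<and> distinct xs)"

definition BigOr :: "'m ufun \<Rightarrow> ('i \<Rightarrow> 'm form) \<Rightarrow> 'i set \<Rightarrow> 'm form" where
  "BigOr S \<phi> A = foldr (\<lambda>i. Or S (\<phi> i)) (enum_of A) (Bot S)"

definition BigAnd :: "'m ufun \<Rightarrow> ('i \<Rightarrow> 'm form) \<Rightarrow> 'i set \<Rightarrow> 'm form" where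
  "BigAnd S \<phi> A = foldr (\<lambda>i. And S (\<phi> i)) (enum_of A) (Top S)"

datatype oper = U | L | P | Pl | Bel | Ps | N

fun oper_sort :: "oper \<Rightarrow> 'm ufun \<Rightarrow> 'm ufun" where
  "oper_sort U S = UpF S"
| "oper_sort L S = UpF S"
| "oper_sort P S = PrF S"
| "oper_sort Pl S = PlF S"
| "oper_sort Bel S = PlF S"
| "oper_sort Ps S = PsF S"
| "oper_sort N S = PsF S"

fun dual :: "oper \<Rightarrow> oper" where
  "dual U = L"
| "dual L = U"
| "dual P = P"
| "dual Pl = Bel"
| "dual Bel = Pl"
| "dual Ps = N"
| "dual N = Ps"

text \<open>$\mathsf{O}_{\ge p}\varphi$, $\mathsf{O}_{\le p}\varphi$ and $\mathsf{O}_{<p}\varphi$ for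
  \<open>\<phi>\<close> of sort \<open>S\<close>. For instance $\mathsf{U}_{\le p}\varphi = [(0,1-p)]\neg\varphi$ and
  $\mathsf{Bel}_{\le p}\varphi = [(1-p,0)]_{Pl}\neg\varphi$.\<close>

fun Ge :: "oper \<Rightarrow> real \<Rightarrow> 'm form \<Rightarrow> 'm form" where
  "Ge U p \<phi> = BoxU p 0 \<phi>"
| "Ge L p \<phi> = BoxU 0 p \<phi>"
| "Ge P p \<phi> = BoxP p \<phi>"
| "Ge Pl p \<phi> = BoxPl p 0 \<phi>"
| "Ge Bel p \<phi> = BoxPl 0 p \<phi>"
| "Ge Ps p \<phi> = BoxPs p 0 \<phi>"
| "Ge N p \<phi> = BoxPs 0 p \<phi>"

definition Le :: "oper \<Rightarrow> 'm ufun \<Rightarrow> real \<Rightarrow> 'm form \<Rightarrow> 'm form" where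
  "Le Q S p \<phi> = Ge (dual Q) (1 - p) (Neg S \<phi>)"

definition Lt :: "oper \<Rightarrow> 'm ufun \<Rightarrow> real \<Rightarrow> 'm form \<Rightarrow> 'm form" where
  "Lt Q S p \<phi> = Neg (oper_sort Q S) (Ge Q p \<phi>)"


section \<open>Axioms\<close>

text \<open>A Boolean tautology is a formula true under every two-valued assignment to its
  subformulas that are neither falsum nor an implication.\<close>

fun bool_val :: "('m form \<Rightarrow> bool) \<Rightarrow> 'm form \<Rightarrow> bool" where
  "bool_val v (Bot S) = False"
| "bool_val v (Imp \<phi> \<psi>) = (bool_val v \<phi> \<longrightarrow> bool_val v \<psi>)"
| "bool_val v \<phi> = v \<phi>"

definition tautology :: "'m form \<Rightarrow> bool" where
  "tautology \<phi> \<longleftrightarrow> (\<forall>v. bool_val v \<phi>)"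

definition nonempty_subsets :: "nat \<Rightarrow> nat set set" where
  "nonempty_subsets n = {I. I \<subseteq> {1..n} \<and> I \<noteq> {}}"

text \<open>$\bigwedge_{\emptyset\ne I\subseteq J_n}\mathsf{Pl}_{[|I|]p_I}\psi_I$ with
  $\psi_I=\bigvee_{i\in I}\varphi_i$.\<close>

definition plaus_premise :: "'m ufun \<Rightarrow> nat \<Rightarrow> (nat \<Rightarrow> 'm form) \<Rightarrow> (nat set \<Rightarrow> real) \<Rightarrow> 'm form" where
  "plaus_premise S n \<phi> p =
     BigAnd (PlF S)
       (\<lambda>I. if odd (card I) then Le Pl S (p I) (BigOr S \<phi> I) else Ge Pl (p I) (BigOr S \<phi> I))
       (nonempty_subsets n)"

definition plaus_bound :: "nat \<Rightarrow> (nat set \<Rightarrow> real) \<Rightarrow> real" where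
  "plaus_bound n p = (\<Sum>I\<in>nonempty_subsets n. (-1) ^ (card I + 1) * p I)"

inductive Ax :: "'m ufun \<Rightarrow> 'm ufun \<Rightarrow> 'm form \<Rightarrow> bool" for T where
  taut: "\<phi> \<in> Form T S \<Longrightarrow> tautology \<phi> \<Longrightarrow> Ax T S \<phi>"
| const_in: "Cst M \<Sigma> A \<in> Form T (ConstF M \<Sigma>) \<Longrightarrow> c \<in> M \<Longrightarrow> c \<in> A \<Longrightarrow>
    Ax T (ConstF M \<Sigma>) (Imp (Cst M \<Sigma> {c}) (Cst M \<Sigma> A))"
| const_notin: "Cst M \<Sigma> A \<in> Form T (ConstF M \<Sigma>) \<Longrightarrow> c \<in> M \<Longrightarrow> c \<notin> A \<Longrightarrow>
    Ax T (ConstF M \<Sigma>) (Imp (Cst M \<Sigma> {c}) (Neg (ConstF M \<Sigma>) (Cst M \<Sigma> A)))"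
| functional: "label_sort T \<kappa> S' S \<Longrightarrow> \<phi> \<in> Form T S' \<Longrightarrow>
    Ax T S (Imp (Neg S (Box \<kappa> \<phi>)) (Box \<kappa> (Neg S' \<phi>)))"
| pr1_bot: "ProdF S1 S2 \<in> Ing T \<Longrightarrow> Ax T (ProdF S1 S2) (Neg (ProdF S1 S2) (Box Pr1 (Bot S1)))"
| pr2_bot: "ProdF S1 S2 \<in> Ing T \<Longrightarrow> Ax T (ProdF S1 S2) (Neg (ProdF S1 S2) (Box Pr2 (Bot S2)))"
| in_bot: "SumF S1 S2 \<in> Ing T \<Longrightarrow>
    Ax T (SumF S1 S2)
      (Iff (SumF S1 S2) (Neg (SumF S1 S2) (Box In1 (Bot S1))) (Box In2 (Bot S2)))"
| next_bot: "Ax T IdF (Neg IdF (Box Next (Bot T)))"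

| le_lt: "Q \<in> {U, P, Pl, Ps} \<Longrightarrow> oper_sort Q S \<in> Ing T \<Longrightarrow> \<phi> \<in> MForm T S \<Longrightarrow>
    p \<in> {0..1} \<Longrightarrow> q \<in> {0..1} \<Longrightarrow> p < q \<Longrightarrow>
    Ax T (oper_sort Q S) (Imp (Le Q S p \<phi>) (Lt Q S q \<phi>))"
| lt_le: "Q \<in> {U, P, Pl, Ps} \<Longrightarrow> oper_sort Q S \<in> Ing T \<Longrightarrow> \<phi> \<in> MForm T S \<Longrightarrow>
    p \<in> {0..1} \<Longrightarrow>
    Ax T (oper_sort Q S) (Imp (Lt Q S p \<phi>) (Le Q S p \<phi>))"
| mono: "Q \<in> {U, P, Pl, Ps} \<Longrightarrow> oper_sort Q S \<in> Ing T \<Longrightarrow> \<phi> \<in> MForm T S \<Longrightarrow>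
    \<psi> \<in> MForm T S \<Longrightarrow> p \<in> {0..1} \<Longrightarrow>
    Ax T (oper_sort Q S) (Imp (Ge (dual Q) 1 (Imp \<phi> \<psi>)) (Imp (Ge Q p \<phi>) (Ge Q p \<psi>)))"

| upper_pair: "UpF S \<in> Ing T \<Longrightarrow> \<phi> \<in> MForm T S \<Longrightarrow> p \<in> {0..1} \<Longrightarrow> q \<in> {0..1} \<Longrightarrow>
    Ax T (UpF S) (Iff (UpF S) (BoxU p q \<phi>) (And (UpF S) (Ge U p \<phi>) (Ge L q \<phi>)))"

| plaus_bel: "PlF S \<in> Ing T \<Longrightarrow> \<phi> \<in> MForm T S \<Longrightarrow> p \<in> {0..1} \<Longrightarrow>
    Ax T (PlF S) (Imp (Le Pl S p \<phi>) (Le Bel S p \<phi>))"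
| plaus_pair: "PlF S \<in> Ing T \<Longrightarrow> \<phi> \<in> MForm T S \<Longrightarrow> p \<in> {0..1} \<Longrightarrow> q \<in> {0..1} \<Longrightarrow>
    Ax T (PlF S) (Iff (PlF S) (BoxPl p q \<phi>) (And (PlF S) (Ge Pl p \<phi>) (Ge Bel q \<phi>)))"
| plaus_incl_excl: "PlF S \<in> Ing T \<Longrightarrow> n \<ge> 1 \<Longrightarrow> \<forall>i\<in>{1..n}. \<phi> i \<in> MForm T S \<Longrightarrow>
    \<forall>I\<in>nonempty_subsets n. p I \<in> {0..1} \<Longrightarrow> plaus_bound n p \<ge> 0 \<Longrightarrow>
    Ax T (PlF S)
      (Imp (plaus_premise S n \<phi> p) (Le Pl S (min (plaus_bound n p) 1) (BigAnd S \<phi> {1..n})))"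
| plaus_incl_excl_neg: "PlF S \<in> Ing T \<Longrightarrow> n \<ge> 1 \<Longrightarrow> \<forall>i\<in>{1..n}. \<phi> i \<in> MForm T S \<Longrightarrow>
    \<forall>I\<in>nonempty_subsets n. p I \<in> {0..1} \<Longrightarrow> plaus_bound n p < 0 \<Longrightarrow>
    Ax T (PlF S) (Neg (PlF S) (plaus_premise S n \<phi> p))"

| poss_bot: "PsF S \<in> Ing T \<Longrightarrow> Ax T (PsF S) (Le Ps S 0 (Bot S))"
| poss_nec: "PsF S \<in> Ing T \<Longrightarrow> \<phi> \<in> MForm T S \<Longrightarrow> p \<in> {0..1} \<Longrightarrow>
    Ax T (PsF S) (Imp (Le Ps S p \<phi>) (Le N S p \<phi>))"
| poss_max: "PsF S \<in> Ing T \<Longrightarrow> \<phi> \<in> MForm T S \<Longrightarrow> \<psi> \<in> MForm T S \<Longrightarrow>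
    p \<in> {0..1} \<Longrightarrow> q \<in> {0..1} \<Longrightarrow>
    Ax T (PsF S)
      (Imp (And (PsF S) (Le Ps S p \<phi>) (Le Ps S q \<psi>)) (Le Ps S (max p q) (Or S \<phi> \<psi>)))"
| poss_pair: "PsF S \<in> Ing T \<Longrightarrow> \<phi> \<in> MForm T S \<Longrightarrow> p \<in> {0..1} \<Longrightarrow> q \<in> {0..1} \<Longrightarrow>
    Ax T (PsF S) (Iff (PsF S) (BoxPs p q \<phi>) (And (PsF S) (Ge Ps p \<phi>) (Ge N q \<phi>)))"


section \<open>Deduction systems\<close>

text \<open>$\bigvee_{I\subseteq J_m,|I|=k}\bigwedge_{i\in I}\varphi_i$\<close>

definition cover :: "'m ufun \<Rightarrow> nat \<Rightarrow> nat \<Rightarrow> (nat \<Rightarrow> 'm form) \<Rightarrow> 'm form" where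
  "cover S m k \<phi> = BigOr S (\<lambda>I. BigAnd S \<phi> I) {I. I \<subseteq> {1..m} \<and> card I = k}"

text \<open>\<open>D S \<Gamma> \<phi>\<close> is $\Gamma\vdash_S\varphi$; by \<open>sorted\<close>, it can only hold for ingredients \<open>S\<close> of
  \<open>T\<close>.\<close>

locale deduction_system =
  fixes T :: "'m ufun" and D :: "'m ufun \<Rightarrow> 'm form set \<Rightarrow> 'm form \<Rightarrow> bool"
  assumes sorted: "D S \<Gamma> \<phi> \<Longrightarrow> \<Gamma> \<subseteq> Form T S \<and> \<phi> \<in> Form T S"
    and assumption: "\<Gamma> \<subseteq> Form T S \<Longrightarrow> \<phi> \<in> \<Gamma> \<or> Ax T S \<phi> \<Longrightarrow> D S \<Gamma> \<phi>"
    and modus_ponens: "\<phi> \<in> Form T S \<Longrightarrow> \<psi> \<in> Form T S \<Longrightarrow> D S {\<phi>, Imp \<phi> \<psi>} \<psi>"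
    and cut: "\<Gamma> \<subseteq> Form T S \<Longrightarrow> (\<And>\<psi>. \<psi> \<in> \<Lambda> \<Longrightarrow> D S \<Gamma> \<psi>) \<Longrightarrow> D S \<Lambda> \<phi> \<Longrightarrow> D S \<Gamma> \<phi>"
    and deduction: "D S (\<Gamma> \<union> {\<phi>}) \<psi> \<Longrightarrow> D S \<Gamma> (Imp \<phi> \<psi>)"
    and constant_rule: "ConstF M \<Sigma> \<in> Ing T \<Longrightarrow>
      D (ConstF M \<Sigma>) {Neg (ConstF M \<Sigma>) (Cst M \<Sigma> {c}) | c. c \<in> M} (Bot (ConstF M \<Sigma>))"
    and definite_box: "label_sort T \<kappa> S' S \<Longrightarrow> D S' \<Gamma> \<psi> \<Longrightarrow> D S (Box \<kappa> ` \<Gamma>) (Box \<kappa> \<psi>)"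
    and necessitation: "Q \<in> {L, P, Bel, N} \<Longrightarrow> oper_sort Q S \<in> Ing T \<Longrightarrow> \<phi> \<in> MForm T S \<Longrightarrow>
      D S {} \<phi> \<Longrightarrow> D (oper_sort Q S) {} (Ge Q 1 \<phi>)"
    and archimedean: "oper_sort Q S \<in> Ing T \<Longrightarrow> \<psi> \<in> MForm T S \<Longrightarrow> p \<in> {0..1} \<Longrightarrow>
      D (oper_sort Q S) {Ge Q q \<psi> | q. q \<in> {0..1} \<and> q < p} (Ge Q p \<psi>)"
    and cover1: "Q \<in> {U, P} \<Longrightarrow> oper_sort Q S \<in> Ing T \<Longrightarrow> m \<ge> 1 \<Longrightarrow> n \<ge> 1 \<Longrightarrow>
      \<phi> \<in> MForm T S \<Longrightarrow> (\<And>i. i \<in> {1..m} \<Longrightarrow> \<phi>s i \<in> MForm T S) \<Longrightarrow>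
      D S {} (Imp \<phi> (cover S m (n + k) \<phi>s)) \<Longrightarrow> D S {} (cover S m k \<phi>s) \<Longrightarrow>
      (\<And>i. i \<in> {1..m} \<Longrightarrow> ps i \<in> {0..1}) \<Longrightarrow>
      D (oper_sort Q S) {}
        (Imp (BigAnd (oper_sort Q S) (\<lambda>i. Le Q S (ps i) (\<phi>s i)) {1..m})
             (Le Q S (max 0 (min 1 (((\<Sum>i=1..m. ps i) - real k) / real n))) \<phi>))"
    and cover2: "Q \<in> {U, P} \<Longrightarrow> oper_sort Q S \<in> Ing T \<Longrightarrow> m \<ge> 1 \<Longrightarrow>
      (\<And>i. i \<in> {1..m} \<Longrightarrow> \<phi>s i \<in> MForm T S) \<Longrightarrow>
      D S {} (cover S m k \<phi>s) \<Longrightarrow>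
      (\<And>i. i \<in> {1..m} \<Longrightarrow> ps i \<in> {0..1}) \<Longrightarrow> (\<Sum>i=1..m. ps i) < real k \<Longrightarrow>
      D (oper_sort Q S) {}
        (Neg (oper_sort Q S) (BigAnd (oper_sort Q S) (\<lambda>i. Le Q S (ps i) (\<phi>s i)) {1..m}))"

definition consistent ::
  "('m ufun \<Rightarrow> 'm form set \<Rightarrow> 'm form \<Rightarrow> bool) \<Rightarrow> 'm ufun \<Rightarrow> 'm form set \<Rightarrow> bool" where
  "consistent D S \<Gamma> \<longleftrightarrow> \<not> D S \<Gamma> (Bot S)"

definition maximal ::
  "'m ufun \<Rightarrow> ('m ufun \<Rightarrow> 'm form set \<Rightarrow> 'm form \<Rightarrow> bool) \<Rightarrow> 'm ufun \<Rightarrow> 'm form set \<Rightarrow> bool" where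
  "maximal T D S \<Gamma> \<longleftrightarrow> \<Gamma> \<subseteq> Form T S \<and> consistent D S \<Gamma> \<and>
     (\<forall>\<phi>\<in>Form T S. \<phi> \<in> \<Gamma> \<longleftrightarrow> Neg S \<phi> \<notin> \<Gamma>)"

definition lindenbaum ::
  "'m ufun \<Rightarrow> ('m ufun \<Rightarrow> 'm form set \<Rightarrow> 'm form \<Rightarrow> bool) \<Rightarrow> bool" where
  "lindenbaum T D \<longleftrightarrow> (\<forall>S\<in>Ing T. \<forall>\<Gamma>. \<Gamma> \<subseteq> Form T S \<and> consistent D S \<Gamma> \<longrightarrow>
     (\<exists>\<Gamma>'. \<Gamma> \<subseteq> \<Gamma>' \<and> maximal T D S \<Gamma>'))"


section \<open>The canonical spaces\<close>

definition canon ::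
  "'m ufun \<Rightarrow> ('m ufun \<Rightarrow> 'm form set \<Rightarrow> 'm form \<Rightarrow> bool) \<Rightarrow> 'm ufun \<Rightarrow> 'm form set set" where
  "canon T D S = {y. maximal T D S y}"

definition truth_set ::
  "'m ufun \<Rightarrow> ('m ufun \<Rightarrow> 'm form set \<Rightarrow> 'm form \<Rightarrow> bool) \<Rightarrow> 'm ufun \<Rightarrow> 'm form \<Rightarrow>
     'm form set set" where
  "truth_set T D S \<phi> = {y \<in> canon T D S. \<phi> \<in> y}"

definition canon_alg ::
  "'m ufun \<Rightarrow> ('m ufun \<Rightarrow> 'm form set \<Rightarrow> 'm form \<Rightarrow> bool) \<Rightarrow> 'm ufun \<Rightarrow>
     'm form set set set" where
  "canon_alg T D S = truth_set T D S ` MForm T S"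

definition prob_value :: "'m form set \<Rightarrow> 'm form \<Rightarrow> real" where
  "prob_value x \<phi> = Sup {q \<in> {0..1}. Ge P q \<phi> \<in> x}"

end

theory Submission
  imports Defs
begin

text \<open>The Archimedean rule and the two order axioms turn \<open>Ge P q \<phi> \<in> x\<close> into \<open>q \<le> v \<phi>\<close> and
  \<open>Le P S q \<phi> \<in> x\<close> into \<open>v \<phi> \<le> q\<close>, where \<open>v = prob_value x\<close>; in particular negation is
  complemented by \<open>v\<close>. The second cover rule then says: if every maximal set of sort \<open>S\<close> contains at
  least \<open>k\<close> of finitely many formulas, their values add up to at least \<open>k\<close>. For disjoint \<open>\<phi>\<close> and
  \<open>\<psi>\<close>, the families \<open>\<phi>, \<psi>, \<not>(\<phi> \<or> \<psi>)\<close> with \<open>k = 1\<close> and \<open>\<not>\<phi>, \<not>\<psi>, \<phi> \<or> \<psi>\<close> with \<open>k = 2\<close> give the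
  two halves of additivity.\<close>

section \<open>Sorts of formulas and of finite Boolean combinations\<close>

lemma Ing_argument: "PrF S \<in> Ing T \<Longrightarrow> S \<in> Ing T"
proof -
  \<comment> \<open>Reflexivity settles the case of the induction where \<open>PrF S\<close> is the
    whole of \<open>T\<close>.\<close>
  have "S \<in> Ing S" for S :: "'a ufun"
    by (cases S) auto
  then show "PrF S \<in> Ing T \<Longrightarrow> S \<in> Ing T"
    by (induction T) auto
qed

lemma Form_Imp: "\<phi> \<in> Form T S \<Longrightarrow> \<psi> \<in> Form T S \<Longrightarrow> Imp \<phi> \<psi> \<in> Form T S"
  by (simp add: Form_def has_sort.Imp)

lemma Form_Bot: "S \<in> Ing T \<Longrightarrow> Bot S \<in> Form T S"
  by (simp add: Form_def has_sort.Bot)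

lemma MForm_imp_Form: "\<phi> \<in> MForm T S \<Longrightarrow> \<phi> \<in> Form T S"
  by (simp add: MForm_def Form_def)

lemma MForm_Imp: "\<phi> \<in> MForm T S \<Longrightarrow> \<psi> \<in> MForm T S \<Longrightarrow> Imp \<phi> \<psi> \<in> MForm T S"
  by (simp add: MForm_def has_sort.Imp)

lemma MForm_Bot: "S \<in> Ing T \<Longrightarrow> Bot S \<in> MForm T S"
  by (simp add: MForm_def has_sort.Bot)

lemma Form_Neg: "S \<in> Ing T \<Longrightarrow> \<phi> \<in> Form T S \<Longrightarrow> Neg S \<phi> \<in> Form T S"
  by (simp add: Neg_def Form_Imp Form_Bot)

lemma MForm_Neg: "S \<in> Ing T \<Longrightarrow> \<phi> \<in> MForm T S \<Longrightarrow> Neg S \<phi> \<in> MForm T S"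
  by (simp add: Neg_def MForm_Imp MForm_Bot)

lemma MForm_Or: "S \<in> Ing T \<Longrightarrow> \<phi> \<in> MForm T S \<Longrightarrow> \<psi> \<in> MForm T S \<Longrightarrow> Or S \<phi> \<psi> \<in> MForm T S"
  by (simp add: Or_def MForm_Imp MForm_Neg)

lemma Form_Or: "S \<in> Ing T \<Longrightarrow> \<phi> \<in> Form T S \<Longrightarrow> \<psi> \<in> Form T S \<Longrightarrow> Or S \<phi> \<psi> \<in> Form T S"
  by (simp add: Or_def Form_Imp Form_Neg)

lemma Form_And: "S \<in> Ing T \<Longrightarrow> \<phi> \<in> Form T S \<Longrightarrow> \<psi> \<in> Form T S \<Longrightarrow> And S \<phi> \<psi> \<in> Form T S"
  by (simp add: And_def Form_Imp Form_Neg)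

lemma Form_Ge_P:
  "PrF S \<in> Ing T \<Longrightarrow> \<phi> \<in> MForm T S \<Longrightarrow> p \<in> {0..1} \<Longrightarrow> Ge P p \<phi> \<in> Form T (PrF S)"
  by (simp add: MForm_def Form_def has_sort.BoxP)

text \<open>Finiteness guarantees a witness for the choice made in \<open>enum_of\<close>.\<close>

lemma set_enum_of: "finite A \<Longrightarrow> set (enum_of A) = A"
  unfolding enum_of_def using finite_distinct_list[of A] by (metis (mono_tags, lifting) someI_ex)

lemma Form_BigOr:
  assumes "S \<in> Ing T" "finite A" "\<And>i. i \<in> A \<Longrightarrow> \<phi> i \<in> Form T S"
  shows "BigOr S \<phi> A \<in> Form T S"
proof -
  \<comment> \<open>The chosen enumeration has no recursive structure, so the induction runs over
    all lists with entries in \<open>A\<close>.\<close>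
  have "foldr (\<lambda>i. Or S (\<phi> i)) xs (Bot S) \<in> Form T S" if "set xs \<subseteq> A" for xs
    using that by (induction xs) (auto intro: Form_Bot Form_Or assms)
  then show ?thesis
    by (simp add: BigOr_def set_enum_of assms(2))
qed

lemma Form_BigAnd:
  assumes "S \<in> Ing T" "finite A" "\<And>i. i \<in> A \<Longrightarrow> \<phi> i \<in> Form T S"
  shows "BigAnd S \<phi> A \<in> Form T S"
proof -
  have "foldr (\<lambda>i. And S (\<phi> i)) xs (Top S) \<in> Form T S" if "set xs \<subseteq> A" for xs
    using that by (induction xs) (auto simp: Top_def intro: Form_Neg Form_Bot Form_And assms)
  then show ?thesis
    by (simp add: BigAnd_def set_enum_of assms(2))
qed

lemma Form_cover:
  assumes "S \<in> Ing T" "\<And>i. i \<in> {1..m} \<Longrightarrow> \<phi> i \<in> Form T S"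
  shows "cover S m k \<phi> \<in> Form T S"
  unfolding cover_def
proof (rule Form_BigOr[OF assms(1)])
  show "finite {I. I \<subseteq> {1..m} \<and> card I = k}"
    by simp
next
  fix I assume "I \<in> {I. I \<subseteq> {1..m} \<and> card I = k}"
  then have I: "I \<subseteq> {1..m}"
    by simp
  show "BigAnd S \<phi> I \<in> Form T S"
    using I assms(2) finite_subset[OF I] by (intro Form_BigAnd[OF assms(1)]) auto
qed

section \<open>Boolean structure of maximal sets\<close>

context deduction_system
begin

text \<open>The rule has only the two premises on its left-hand side; cut carries it to an arbitrary
  context.\<close>

lemma provable_mp:
  assumes "D S \<Gamma> (Imp \<phi> \<psi>)" "D S \<Gamma> \<phi>" "\<psi> \<in> Form T S"
  shows "D S \<Gamma> \<psi>"
proof (rule cut)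
  show "D S {\<phi>, Imp \<phi> \<psi>} \<psi>"
    using assms sorted modus_ponens by blast
qed (use assms sorted in auto)

context
  fixes S and y
  assumes S: "S \<in> Ing T" and y: "maximal T D S y"
begin

lemma maximal_Form: "\<phi> \<in> y \<Longrightarrow> \<phi> \<in> Form T S"
  using y by (auto simp: maximal_def)

lemma maximal_Bot: "Bot S \<notin> y"
  using y assumption[of y S "Bot S"] by (auto simp: maximal_def consistent_def)

lemma maximal_Neg: "\<phi> \<in> Form T S \<Longrightarrow> Neg S \<phi> \<in> y \<longleftrightarrow> \<phi> \<notin> y"
  using y by (auto simp: maximal_def)

text \<open>If \<open>\<phi>\<close> were missing, negation completeness would put its negation into
  \<open>y\<close>; then \<open>y\<close> would derive both and hence falsum, against
  consistency.\<close>

lemma maximal_closed: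
  assumes "D S \<Gamma> \<phi>" "\<Gamma> \<subseteq> y"
  shows "\<phi> \<in> y"
proof (rule ccontr)
  assume "\<phi> \<notin> y"
  then have "Neg S \<phi> \<in> y"
    using maximal_Neg assms(1) sorted by blast
  moreover have "y \<subseteq> Form T S"
    using maximal_Form by blast
  ultimately have "D S y (Imp \<phi> (Bot S))"
    using assumption by (simp add: Neg_def)
  moreover have "D S y \<phi>"
    using cut[of y S \<Gamma>] assms assumption \<open>y \<subseteq> Form T S\<close> by blast
  ultimately have "D S y (Bot S)"
    using provable_mp Form_Bot[OF S] by blast
  then show False
    using y by (simp add: maximal_def consistent_def)
qed

lemma maximal_Ax: "Ax T S \<phi> \<Longrightarrow> \<phi> \<in> y"
  using maximal_closed assumption[of "{}"] by blast

lemma maximal_mp: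
  assumes "Imp \<phi> \<psi> \<in> y" "\<phi> \<in> y" "\<psi> \<in> Form T S"
  shows "\<psi> \<in> y"
  using maximal_closed[OF modus_ponens[of \<phi> S \<psi>]] maximal_Form assms by blast

lemma maximal_Imp:
  assumes "\<phi> \<in> Form T S" "\<psi> \<in> Form T S"
  shows "Imp \<phi> \<psi> \<in> y \<longleftrightarrow> (\<phi> \<in> y \<longrightarrow> \<psi> \<in> y)"
proof
  assume "Imp \<phi> \<psi> \<in> y"
  then show "\<phi> \<in> y \<longrightarrow> \<psi> \<in> y"
    using maximal_mp assms(2) by blast
next
  \<comment> \<open>One tautology for each way in which an implication can be true.\<close>
  have "Imp (Neg S \<phi>) (Imp \<phi> \<psi>) \<in> y" "Imp \<psi> (Imp \<phi> \<psi>) \<in> y"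
    by (rule maximal_Ax, rule Ax.taut;
        auto intro!: Form_Imp Form_Bot S assms simp: tautology_def Neg_def)+
  moreover assume "\<phi> \<in> y \<longrightarrow> \<psi> \<in> y"
  then have "Neg S \<phi> \<in> y \<or> \<psi> \<in> y"
    using maximal_Neg assms(1) by blast
  ultimately show "Imp \<phi> \<psi> \<in> y"
    using maximal_mp Form_Imp assms by blast
qed

lemma maximal_Or:
  "\<phi> \<in> Form T S \<Longrightarrow> \<psi> \<in> Form T S \<Longrightarrow> Or S \<phi> \<psi> \<in> y \<longleftrightarrow> \<phi> \<in> y \<or> \<psi> \<in> y"
  by (auto simp: Or_def maximal_Imp maximal_Neg Form_Neg S)

lemma maximal_And:
  "\<phi> \<in> Form T S \<Longrightarrow> \<psi> \<in> Form T S \<Longrightarrow> And S \<phi> \<psi> \<in> y \<longleftrightarrow> \<phi> \<in> y \<and> \<psi> \<in> y"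
  by (auto simp: And_def maximal_Imp maximal_Neg Form_Neg Form_Imp S)

lemma maximal_BigOr:
  assumes "finite A" "\<And>i. i \<in> A \<Longrightarrow> \<phi> i \<in> Form T S"
  shows "BigOr S \<phi> A \<in> y \<longleftrightarrow> (\<exists>i\<in>A. \<phi> i \<in> y)"
proof -
  let ?f = "\<lambda>xs. foldr (\<lambda>i. Or S (\<phi> i)) xs (Bot S)"
  \<comment> \<open>The sort of the fold is carried along because \<open>maximal_Or\<close> requires
    it of the tail.\<close>
  have "?f xs \<in> Form T S \<and> (?f xs \<in> y \<longleftrightarrow> (\<exists>i\<in>set xs. \<phi> i \<in> y))" if "set xs \<subseteq> A" for xs
    using that
    by (induction xs) (auto simp: maximal_Bot maximal_Or Form_Or Form_Bot S assms(2))
  then show ?thesis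
    by (simp add: BigOr_def set_enum_of assms(1))
qed

lemma maximal_BigAnd:
  assumes "finite A" "\<And>i. i \<in> A \<Longrightarrow> \<phi> i \<in> Form T S"
  shows "BigAnd S \<phi> A \<in> y \<longleftrightarrow> (\<forall>i\<in>A. \<phi> i \<in> y)"
proof -
  let ?f = "\<lambda>xs. foldr (\<lambda>i. And S (\<phi> i)) xs (Top S)"
  have "?f xs \<in> Form T S \<and> (?f xs \<in> y \<longleftrightarrow> (\<forall>i\<in>set xs. \<phi> i \<in> y))" if "set xs \<subseteq> A" for xs
    using that
    by (induction xs)
      (auto simp: Top_def maximal_Bot maximal_Neg maximal_And Form_And Form_Bot Form_Neg S assms(2))
  then show ?thesis
    by (simp add: BigAnd_def set_enum_of assms(1))
qed

text \<open>The disjunction asks for a \<open>k\<close>-element set of indices whose formulas all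
  lie in \<open>y\<close>. Such a set exists exactly when enough indices are available, so the cover
  rules become statements about counting.\<close>

lemma maximal_cover:
  assumes "\<And>i. i \<in> {1..m} \<Longrightarrow> \<phi> i \<in> Form T S"
  shows "cover S m k \<phi> \<in> y \<longleftrightarrow> k \<le> card {i \<in> {1..m}. \<phi> i \<in> y}"
proof -
  let ?A = "{I. I \<subseteq> {1..m} \<and> card I = k}"
  have fin: "finite I" if "I \<in> ?A" for I
    using that finite_subset by blast
  have sub: "\<phi> i \<in> Form T S" if "I \<in> ?A" "i \<in> I" for I i
    using that assms by blast
  have "cover S m k \<phi> \<in> y \<longleftrightarrow> (\<exists>I\<in>?A. BigAnd S \<phi> I \<in> y)"
    unfolding cover_def
    by (rule maximal_BigOr) (simp, rule Form_BigAnd[OF S fin sub])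
  also have "\<dots> \<longleftrightarrow> (\<exists>I\<in>?A. \<forall>i\<in>I. \<phi> i \<in> y)"
    by (intro bex_cong refl maximal_BigAnd[OF fin sub])
  also have "\<dots> \<longleftrightarrow> k \<le> card {i \<in> {1..m}. \<phi> i \<in> y}"
  proof
    assume "\<exists>I\<in>?A. \<forall>i\<in>I. \<phi> i \<in> y"
    then obtain I where "I \<subseteq> {i \<in> {1..m}. \<phi> i \<in> y}" "card I = k"
      by blast
    then show "k \<le> card {i \<in> {1..m}. \<phi> i \<in> y}"
      using card_mono[of "{i \<in> {1..m}. \<phi> i \<in> y}" I] by simp
  next
    assume "k \<le> card {i \<in> {1..m}. \<phi> i \<in> y}"
    then obtain I where "I \<subseteq> {i \<in> {1..m}. \<phi> i \<in> y}" "card I = k"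
      using obtain_subset_with_card_n by blast
    then show "\<exists>I\<in>?A. \<forall>i\<in>I. \<phi> i \<in> y"
      by blast
  qed
  finally show ?thesis .
qed

end

section \<open>Provability from membership in all maximal sets\<close>

text \<open>By the Lindenbaum property, if the negation of \<open>\<phi>\<close> were consistent, it
  would lie in some maximal set, which could not contain \<open>\<phi>\<close>. So it is
  inconsistent, and deduction yields the double negation of \<open>\<phi>\<close>.\<close>

lemma provable_if_in_all_maximal:
  assumes "lindenbaum T D" and S: "S \<in> Ing T" and \<phi>: "\<phi> \<in> Form T S"
    and all: "\<And>y. maximal T D S y \<Longrightarrow> \<phi> \<in> y"
  shows "D S {} \<phi>"
proof -
  have "\<not> consistent D S {Neg S \<phi>}"
  proof
    assume "consistent D S {Neg S \<phi>}"
    then obtain y where "maximal T D S y" "Neg S \<phi> \<in> y"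
      using assms(1) S Form_Neg[OF S \<phi>] unfolding lindenbaum_def by blast
    then show False
      using all maximal_Neg[OF S] \<phi> by blast
  qed
  then have "D S {} (Neg S (Neg S \<phi>))"
    using deduction[of S "{}" "Neg S \<phi>" "Bot S"] by (simp add: consistent_def Neg_def)
  moreover have "D S {} (Imp (Neg S (Neg S \<phi>)) \<phi>)"
    by (rule assumption)
      (auto intro!: Ax.taut Form_Imp Form_Bot S \<phi> simp: tautology_def Neg_def)
  ultimately show ?thesis
    using provable_mp \<phi> by blast
qed

end

section \<open>The value function of a maximal set of sort \<open>PrF S\<close>\<close>

locale canonical_point = deduction_system T D
  for T :: "'m ufun" and D +
  fixes S :: "'m ufun" and x :: "'m form set"
  assumes lind: "lindenbaum T D"
    and R: "PrF S \<in> Ing T"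
    and x: "maximal T D (PrF S) x"
begin

lemma S: "S \<in> Ing T"
  using R by (rule Ing_argument)

abbreviation "v \<equiv> prob_value x"

text \<open>This is the Archimedean rule inside \<open>x\<close>. At \<open>p = 0\<close> there are
  no premises, so \<open>Ge P 0 \<phi>\<close> always lies in \<open>x\<close>.\<close>

lemma Ge_P_closed:
  assumes "\<phi> \<in> MForm T S" "p \<in> {0..1}" "\<And>q. q \<in> {0..1} \<Longrightarrow> q < p \<Longrightarrow> Ge P q \<phi> \<in> x"
  shows "Ge P p \<phi> \<in> x"
proof (rule maximal_closed[OF R x])
  show "D (PrF S) {Ge P q \<phi> |q. q \<in> {0..1} \<and> q < p} (Ge P p \<phi>)"
    using archimedean[of P S \<phi> p] assms R by simp
qed (use assms in auto)

lemma not_Ge_P_imp_Le_P: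
  assumes "\<phi> \<in> MForm T S" "p \<in> {0..1}" "Ge P p \<phi> \<notin> x"
  shows "Le P S p \<phi> \<in> x"
proof -
  have "Imp (Lt P S p \<phi>) (Le P S p \<phi>) \<in> x"
    using maximal_Ax[OF R x] Ax.lt_le[of P S T \<phi> p] assms R by simp
  moreover have "Lt P S p \<phi> \<in> x"
    using maximal_Neg[OF R x] Form_Ge_P[OF R] assms by (simp add: Lt_def)
  moreover have "Le P S p \<phi> \<in> Form T (PrF S)"
    using Form_Ge_P[OF R MForm_Neg[OF S assms(1)], of "1 - p"] assms(2) by (simp add: Le_def)
  ultimately show ?thesis
    using maximal_mp[OF R x] by blast
qed

lemma Le_P_imp_not_Ge_P:
  assumes "\<phi> \<in> MForm T S" "p \<in> {0..1}" "q \<in> {0..1}" "p < q" "Le P S p \<phi> \<in> x"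
  shows "Ge P q \<phi> \<notin> x"
proof -
  have "Imp (Le P S p \<phi>) (Lt P S q \<phi>) \<in> x"
    using maximal_Ax[OF R x] Ax.le_lt[of P S T \<phi> p q] assms R by simp
  moreover have "Lt P S q \<phi> \<in> Form T (PrF S)"
    using Form_Neg[OF R] Form_Ge_P[OF R] assms by (simp add: Lt_def)
  ultimately have "Lt P S q \<phi> \<in> x"
    using maximal_mp[OF R x] assms(5) by blast
  then show ?thesis
    using maximal_Neg[OF R x] Form_Ge_P[OF R] assms by (simp add: Lt_def)
qed

lemma prob_value_bounds:
  assumes "\<phi> \<in> MForm T S"
  shows "v \<phi> \<in> {0..1}"
proof -
  \<comment> \<open>The set under the supremum is thus nonempty, as \<open>cSup_least\<close>
    demands, and 0 is a lower bound for its supremum.\<close>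
  have "Ge P 0 \<phi> \<in> x"
    using Ge_P_closed[OF assms] by auto
  then have mem: "0 \<in> {q \<in> {0..1}. Ge P q \<phi> \<in> x}"
    by simp
  then have "0 \<le> v \<phi>"
    unfolding prob_value_def by (intro cSup_upper bdd_aboveI[of _ 1]) auto
  moreover have "v \<phi> \<le> 1"
    unfolding prob_value_def by (rule cSup_least) (use mem in blast, simp)
  ultimately show ?thesis
    by simp
qed

text \<open>The Archimedean rule makes the supremum attained, and the order axioms make the set of
  thresholds downward closed.\<close>

lemma Ge_P_iff:
  assumes "\<phi> \<in> MForm T S" "p \<in> {0..1}"
  shows "Ge P p \<phi> \<in> x \<longleftrightarrow> p \<le> v \<phi>"
proof
  assume "Ge P p \<phi> \<in> x"
  then show "p \<le> v \<phi>"
    unfolding prob_value_def using assms by (intro cSup_upper bdd_aboveI[of _ 1]) auto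
next
  assume p: "p \<le> v \<phi>"
  show "Ge P p \<phi> \<in> x"
  proof (rule Ge_P_closed[OF assms])
    fix q :: real assume q: "q \<in> {0..1}" "q < p"
    let ?A = "{q \<in> {0..1}. Ge P q \<phi> \<in> x}"
    have "0 \<in> ?A"
      using Ge_P_closed[OF assms(1), of 0] by auto
    moreover have "q < Sup ?A"
      using q p by (simp add: prob_value_def)
    ultimately obtain r where "r \<in> ?A" "q < r"
      using less_cSupD[of ?A q] by blast
    then show "Ge P q \<phi> \<in> x"
      \<comment> \<open>If \<open>Ge P q \<phi>\<close> failed, \<open>Le P S q \<phi>\<close> would
        hold and exclude \<open>Ge P r \<phi>\<close> for the larger \<open>r\<close>.\<close>
      using not_Ge_P_imp_Le_P[OF assms(1) q(1)] Le_P_imp_not_Ge_P[OF assms(1) q(1)] by auto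
  qed
qed

lemma Le_P_iff:
  assumes "\<phi> \<in> MForm T S" "p \<in> {0..1}"
  shows "Le P S p \<phi> \<in> x \<longleftrightarrow> v \<phi> \<le> p"
proof
  assume le: "Le P S p \<phi> \<in> x"
  show "v \<phi> \<le> p"
  proof (rule ccontr)
    assume "\<not> v \<phi> \<le> p"
    \<comment> \<open>The value itself is a threshold in \<open>x\<close>, which
      \<open>Le P S p \<phi>\<close> forbids above \<open>p\<close>.\<close>
    then show False
      using Le_P_imp_not_Ge_P[OF assms _ _ le, of "v \<phi>"] prob_value_bounds[OF assms(1)]
        Ge_P_iff[OF assms(1), of "v \<phi>"] by auto
  qed
next
  assume p: "v \<phi> \<le> p"
  have "Ge P (1 - p) (Neg S \<phi>) \<in> x"
  proof (rule Ge_P_closed[OF MForm_Neg[OF S assms(1)]])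
    fix q :: real assume q: "q \<in> {0..1}" "q < 1 - p"
    \<comment> \<open>Here \<open>1 - q > p\<close>, which bounds the value. The resulting
      \<open>Le P S (1 - q) \<phi>\<close> is literally the required
      \<open>Ge P q (Neg S \<phi>)\<close>.\<close>
    then have "Ge P (1 - q) \<phi> \<notin> x"
      using Ge_P_iff[OF assms(1), of "1 - q"] p by simp
    then show "Ge P q (Neg S \<phi>) \<in> x"
      using not_Ge_P_imp_Le_P[OF assms(1), of "1 - q"] q by (simp add: Le_def)
  qed (use assms in simp)
  then show "Le P S p \<phi> \<in> x"
    by (simp add: Le_def)
qed

lemma prob_value_Neg:
  assumes "\<phi> \<in> MForm T S"
  shows "v (Neg S \<phi>) = 1 - v \<phi>"
proof (rule antisym)
  \<comment> \<open>Both sides describe membership of one formula, since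
    \<open>Le P S (1 - p) \<phi>\<close> is \<open>Ge P p (Neg S \<phi>)\<close>. Taking
    \<open>p\<close> to be either of the two values to be compared gives the two
    inequalities.\<close>
  have iff: "p \<le> v (Neg S \<phi>) \<longleftrightarrow> v \<phi> \<le> 1 - p" if "p \<in> {0..1}" for p
    using Ge_P_iff[OF MForm_Neg[OF S assms] that] Le_P_iff[OF assms, of "1 - p"] that
    by (simp add: Le_def)
  show "v (Neg S \<phi>) \<le> 1 - v \<phi>"
    using iff[OF prob_value_bounds[OF MForm_Neg[OF S assms]]] by simp
  show "1 - v \<phi> \<le> v (Neg S \<phi>)"
    using iff[of "1 - v \<phi>"] prob_value_bounds[OF assms] by simp
qed

lemma prob_value_provable:
  assumes "\<phi> \<in> MForm T S" "D S {} \<phi>"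
  shows "v \<phi> = 1"
proof -
  have "Ge P 1 \<phi> \<in> x"
    using maximal_closed[OF R x] necessitation[of P S \<phi>] assms R by auto
  then show ?thesis
    using Ge_P_iff[OF assms(1), of 1] prob_value_bounds[OF assms(1)] by simp
qed

section \<open>Monotonicity, covers and additivity\<close>

text \<open>Inclusion of truth sets puts the implication into every maximal set, so it is provable
  and has value 1. The monotonicity axiom then transfers thresholds from \<open>\<phi>\<close> to
  \<open>\<psi>\<close>.\<close>

lemma prob_value_mono:
  assumes "\<phi> \<in> MForm T S" "\<psi> \<in> MForm T S" "truth_set T D S \<phi> \<subseteq> truth_set T D S \<psi>"
  shows "v \<phi> \<le> v \<psi>"
proof -
  have imp: "Imp \<phi> \<psi> \<in> MForm T S"
    using assms MForm_Imp by blast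
  have "Imp \<phi> \<psi> \<in> y" if "maximal T D S y" for y
    using that assms
    by (auto simp: maximal_Imp[OF S that] MForm_imp_Form truth_set_def canon_def)
  then have "D S {} (Imp \<phi> \<psi>)"
    using provable_if_in_all_maximal[OF lind S] imp MForm_imp_Form by blast
  then have "Ge P 1 (Imp \<phi> \<psi>) \<in> x"
    using prob_value_provable Ge_P_iff[OF imp, of 1] imp by simp
  moreover have
    \<comment> \<open>The threshold is the attained value of \<open>\<phi>\<close>, so the inner
      premise lies in \<open>x\<close> too.\<close>
    "Imp (Ge P 1 (Imp \<phi> \<psi>)) (Imp (Ge P (v \<phi>) \<phi>) (Ge P (v \<phi>) \<psi>)) \<in> x"
    using maximal_Ax[OF R x] Ax.mono[of P S T \<phi> \<psi> "v \<phi>"] assms R prob_value_bounds by simp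
  ultimately have "Imp (Ge P (v \<phi>) \<phi>) (Ge P (v \<phi>) \<psi>) \<in> x"
    using maximal_mp[OF R x] Form_Imp Form_Ge_P[OF R] assms prob_value_bounds by blast
  then have "Ge P (v \<phi>) \<psi> \<in> x"
    using maximal_mp[OF R x] Ge_P_iff Form_Ge_P[OF R] assms prob_value_bounds by blast
  then show ?thesis
    using Ge_P_iff assms prob_value_bounds by blast
qed

lemma prob_value_cover:
  fixes m k :: nat
  assumes "m \<ge> 1" and \<phi>: "\<And>i. i \<in> {1..m} \<Longrightarrow> \<phi> i \<in> MForm T S"
    and "\<And>y. maximal T D S y \<Longrightarrow> k \<le> card {i \<in> {1..m}. \<phi> i \<in> y}"
  shows "real k \<le> (\<Sum>i=1..m. v (\<phi> i))"
proof (rule ccontr)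
  assume less: "\<not> ?thesis"
  \<comment> \<open>With the values themselves as upper bounds, every conjunct lies in
    \<open>x\<close>; a sum below \<open>k\<close> would make the conjunction refutable by the
    second cover rule.\<close>
  let ?B = "BigAnd (PrF S) (\<lambda>i. Le P S (v (\<phi> i)) (\<phi> i)) {1..m}"
  have form: "\<phi> i \<in> Form T S" if "i \<in> {1..m}" for i
    using \<phi> MForm_imp_Form that by blast
  have "D S {} (cover S m k \<phi>)"
    using provable_if_in_all_maximal[OF lind S] maximal_cover[OF S] Form_cover[OF S] form assms(3)
    by simp
  then have "D (PrF S) {} (Neg (PrF S) ?B)"
    using cover2[of P S m \<phi> k "\<lambda>i. v (\<phi> i)"] less assms(1) \<phi> prob_value_bounds R by simp
  then have "Neg (PrF S) ?B \<in> x"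
    using maximal_closed[OF R x] by blast
  have le: "Le P S (v (\<phi> i)) (\<phi> i) \<in> x" if "i \<in> {1..m}" for i
    using Le_P_iff \<phi> prob_value_bounds that by blast
  then have "?B \<in> x"
    using maximal_BigAnd[OF R x, of "{1..m}"] maximal_Form[OF R x] by simp
  then show False
    using \<open>Neg (PrF S) ?B \<in> x\<close> maximal_Neg[OF R x] maximal_Form[OF R x] by blast
qed

lemma prob_value_cover3:
  assumes "\<phi> \<in> MForm T S" "\<psi> \<in> MForm T S" "\<chi> \<in> MForm T S"
    and "\<And>y. maximal T D S y \<Longrightarrow> k \<le> of_bool (\<phi> \<in> y) + of_bool (\<psi> \<in> y) + of_bool (\<chi> \<in> y)"
  shows "real k \<le> v \<phi> + v \<psi> + v \<chi>"
proof -
  define f where "f i = (if i = 1 then \<phi> else if i = 2 then \<psi> else \<chi>)" for i :: nat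
  have three: "{1..3::nat} = {1, 2, 3}"
    by auto
  have "card {i \<in> {1..3}. f i \<in> y} = of_bool (\<phi> \<in> y) + of_bool (\<psi> \<in> y) + of_bool (\<chi> \<in> y)" for y
  proof -
    have "card {i \<in> {1..3}. f i \<in> y} = (\<Sum>i\<in>{1..3}. of_bool (f i \<in> y))"
      by (simp add: Int_def)
    also have "\<dots> = of_bool (\<phi> \<in> y) + of_bool (\<psi> \<in> y) + of_bool (\<chi> \<in> y)"
      \<comment> \<open>The deleted rule would fold the sum of indicators back into a
        cardinality.\<close>
      unfolding three by (simp add: f_def del: sum_of_bool_eq)
    finally show ?thesis .
  qed
  then have "real k \<le> (\<Sum>i=1..3. v (f i))"
    using assms by (intro prob_value_cover) (auto simp: f_def)
  then show ?thesis
    unfolding three by (simp add: f_def)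
qed

lemma prob_value_Or_disjoint:
  assumes "\<phi> \<in> MForm T S" "\<psi> \<in> MForm T S"
    and "truth_set T D S \<phi> \<inter> truth_set T D S \<psi> = {}"
  shows "v (Or S \<phi> \<psi>) = v \<phi> + v \<psi>"
proof (rule antisym)
  note forms = assms(1,2) MForm_Neg[OF S] MForm_Or[OF S]
  note mem = maximal_Neg[OF S] maximal_Or[OF S] MForm_imp_Form forms
  \<comment> \<open>Every maximal set contains one of the three formulas; rewriting the negation as
    a complement gives subadditivity.\<close>
  have "real 1 \<le> v \<phi> + v \<psi> + v (Neg S (Or S \<phi> \<psi>))"
    by (rule prob_value_cover3) (auto simp: mem)
  then show "v (Or S \<phi> \<psi>) \<le> v \<phi> + v \<psi>"
    by (simp add: prob_value_Neg forms)
  have "\<not> (\<phi> \<in> y \<and> \<psi> \<in> y)" if "maximal T D S y" for y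
    using assms(3) that by (auto simp: truth_set_def canon_def)
  \<comment> \<open>A maximal set with neither formula contains both negations; one with exactly one
    formula contains the other's negation and the disjunction. Disjointness excludes the remaining
    case.\<close>
  then have "real 2 \<le> v (Neg S \<phi>) + v (Neg S \<psi>) + v (Or S \<phi> \<psi>)"
    by (intro prob_value_cover3) (auto simp: mem)
  then show "v \<phi> + v \<psi> \<le> v (Or S \<phi> \<psi>)"
    by (simp add: prob_value_Neg forms)
qed

section \<open>The algebra of truth sets and the measure on it\<close>

lemma truth_set_Bot: "truth_set T D S (Bot S) = {}"
  using maximal_Bot[OF S] by (auto simp: truth_set_def canon_def)

lemma truth_set_Neg:
  "\<phi> \<in> MForm T S \<Longrightarrow> truth_set T D S (Neg S \<phi>) = canon T D S - truth_set T D S \<phi>"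
  by (auto simp: truth_set_def canon_def maximal_Neg[OF S] MForm_imp_Form)

lemma truth_set_Or:
  "\<phi> \<in> MForm T S \<Longrightarrow> \<psi> \<in> MForm T S \<Longrightarrow>
    truth_set T D S (Or S \<phi> \<psi>) = truth_set T D S \<phi> \<union> truth_set T D S \<psi>"
  by (auto simp: truth_set_def canon_def maximal_Or[OF S] MForm_imp_Form)

lemma algebra_canon_alg: "algebra (canon T D S) (canon_alg T D S)"
  unfolding algebra_iff_Un canon_alg_def
proof (intro conjI ballI)
  show "truth_set T D S ` MForm T S \<subseteq> Pow (canon T D S)"
    by (auto simp: truth_set_def)
  show "{} \<in> truth_set T D S ` MForm T S"
    using truth_set_Bot MForm_Bot[OF S] by blast
  show "canon T D S - U \<in> truth_set T D S ` MForm T S" if "U \<in> truth_set T D S ` MForm T S" for U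
    using that truth_set_Neg MForm_Neg[OF S] by blast
  show "U \<union> V \<in> truth_set T D S ` MForm T S"
    if "U \<in> truth_set T D S ` MForm T S" "V \<in> truth_set T D S ` MForm T S" for U V
    using that truth_set_Or MForm_Or[OF S] by blast
qed

text \<open>Every member of the algebra is a truth set, so the hypothesis fixes \<mu> there, and the
  measure laws reduce to those of the values without mention of chosen representatives.\<close>

lemma fin_add_prob_canon:
  assumes \<mu>: "\<And>\<phi>. \<phi> \<in> MForm T S \<Longrightarrow> \<mu> (truth_set T D S \<phi>) = v \<phi>"
  shows "fin_add_prob (canon T D S) (canon_alg T D S) \<mu>"
  unfolding fin_add_prob_def
proof (intro conjI ballI impI)
  note bot = MForm_Bot[OF S]
  have "D S {} (Neg S (Bot S))"
    using provable_if_in_all_maximal[OF lind S] maximal_Neg[OF S] maximal_Bot[OF S] Form_Bot[OF S]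
      Form_Neg[OF S] by blast
  \<comment> \<open>Verum has the whole space as truth set and is provable; complementation then
    gives falsum the value 0.\<close>
  then have top: "v (Neg S (Bot S)) = 1"
    using prob_value_provable MForm_Neg[OF S bot] by blast
  then show "\<mu> {} = 0"
    using \<mu>[OF bot] prob_value_Neg[OF bot] by (simp add: truth_set_Bot)
  show "\<mu> (canon T D S) = 1"
    using \<mu>[OF MForm_Neg[OF S bot]] top truth_set_Neg[OF bot] by (simp add: truth_set_Bot)
  show "0 \<le> \<mu> U" "\<mu> U \<le> 1" if "U \<in> canon_alg T D S" for U
    using that \<mu> prob_value_bounds by (auto simp: canon_alg_def)
  fix U V
  assume "U \<in> canon_alg T D S" "V \<in> canon_alg T D S" and disj: "U \<inter> V = {}"
  then obtain \<phi> \<psi> where U: "U = truth_set T D S \<phi>" "\<phi> \<in> MForm T S"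
    and V: "V = truth_set T D S \<psi>" "\<psi> \<in> MForm T S"
    by (auto simp: canon_alg_def)
  then have "\<mu> (U \<union> V) = v (Or S \<phi> \<psi>)"
    using \<mu>[OF MForm_Or[OF S U(2) V(2)]] by (simp add: truth_set_Or)
  then show "\<mu> (U \<union> V) = \<mu> U + \<mu> V"
    using prob_value_Or_disjoint U V disj \<mu> by simp
qed (rule algebra_canon_alg)

end

theorem theorem5p6:
  fixes T S :: "'m ufun"
    and D :: "'m ufun \<Rightarrow> 'm form set \<Rightarrow> 'm form \<Rightarrow> bool"
    and x :: "'m form set"
  assumes "uncertainty_functor T"
    and "deduction_system T D"
    and "lindenbaum T D"
    and "PrF S \<in> Ing T"
    and "x \<in> canon T D (PrF S)"
  shows "(\<forall>\<phi>\<in>MForm T S. \<forall>\<psi>\<in>MForm T S.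
            truth_set T D S \<phi> = truth_set T D S \<psi> \<longrightarrow> prob_value x \<phi> = prob_value x \<psi>) \<and>
         (\<exists>\<mu>. (\<forall>\<phi>\<in>MForm T S. \<mu> (truth_set T D S \<phi>) = prob_value x \<phi>) \<and>
              fin_add_prob (canon T D S) (canon_alg T D S) \<mu>)"
proof -
  interpret deduction_system T D
    by fact
  interpret canonical_point T D S x
    by unfold_locales (use assms in \<open>auto simp: canon_def\<close>)
  \<comment> \<open>Equal truth sets are included in each other, so monotonicity applies both
    ways.\<close>
  have wd: "prob_value x \<phi> = prob_value x \<psi>"
    if "\<phi> \<in> MForm T S" "\<psi> \<in> MForm T S" "truth_set T D S \<phi> = truth_set T D S \<psi>" for \<phi> \<psi>
    using that prob_value_mono by (intro antisym) auto
  \<comment> \<open>The inverse picks some measurable formula with truth set \<open>U\<close>; by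
    \<open>wd\<close> its value does not depend on the choice.\<close>
  define \<mu> where "\<mu> U = prob_value x (inv_into (MForm T S) (truth_set T D S) U)" for U
  have "\<mu> (truth_set T D S \<phi>) = prob_value x \<phi>" if "\<phi> \<in> MForm T S" for \<phi>
    unfolding \<mu>_def using that
    by (intro wd inv_into_into f_inv_into_f[of _ "truth_set T D S"] imageI)
  then show ?thesis
    using wd fin_add_prob_canon by blast
qed

end
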